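(* Let $D\ge 4$ be an integer. The algorithm $O\mathrm{Sequences}(D)$ described in the context terminates and returns the list $O=[O_1,O_2,\dots,O_D]$, where $O_d$ denotes the number of finite $O$-sequences of multiplicity $d$, for every $1\le d\le D$.
   Context: Let $K$ be a field. An $O$-sequence is a numerical function $(a_0,a_1,\dots)$ that is the Hilbert function $t\mapsto \dim_K R_t-\dim_K I_t$ of some $R/I$, with $I$ a homogeneous ideal of a standard graded polynomial ring $R=K[x_1,\dots,x_p]$. A finite $O$-sequence is one that is eventually zero, written $(a_0,\dots,a_s)$ with $a_s\ne0$; its multiplicity is $\sum_{i=0}^s a_i$. Equivalently (Macaulay), a finite sequence of positive integers $(a_0,\dots,a_s)$ is a finite $O$-sequence if and only if $a_0=1$ and $a_{t+1}\le a_t^{\langle t\rangle}$ for all $1\le t<s$. Here, for positive integers $a,t$ with (unique) binomial expansion $a=\binom{k(t)}{t}+\binom{k(t-1)}{t-1}+\dots+\binom{k(j)}{j}$, $k(t)>k(t-1)>\dots>k(j)\ge j\ge 1$, one sets $a^{\langle t\rangle}=\binom{k(t)+1}{t+1}+\binom{k(t-1)+1}{t}+\dots+\binom{k(j)+1}{j+1}$. Algorithm $O\mathrm{Sequences}(D)$ (lists are indexed from $1$): 1. Initialize $O:=[1,1,2,3]$, $A:=[0,0,1,1]$. Let $B$ be a list of three lists of sequences: $B[1]:=[(1,2)]$, $B[2]:=[(1,3)]$, $B[3]:=[\,]$ (empty). Set $h_2:=1$, $h_1:=2$, $h:=3$. 2. For $d=5,\dots,D$ do: (a) let $B[h]$ be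 the list of the sequences obtained as follows: from each $(a_0,\dots,a_s)$ in $B[h_2]$ the sequence $(a_0,\dots,a_s,2)$, and from each $(a_0,\dots,a_s)$ in $B[h_1]$ the sequence $(a_0,\dots,a_{s-1},a_s+1)$, whenever possible, i.e. whenever it is an $O$-sequence; (b) append the cardinality of $B[h]$ to the end of $A$ (so it becomes $A[d]$); (c) append $A[d]+O[d-1]$ to the end of $O$; (d) set $a:=h_2$, $h_2:=h_1$, $h_1:=h$, $h:=a$. 3. Return $O$. *)

theory Defs
  imports
    Complex_Main
    "HOL-Library.Poly_Mapping"
    "HOL-Library.More_List"
    "HOL-Library.While_Combinator"
begin

text \<open>
  Polynomials over \<open>'k\<close> in the variables \<open>x\<^sub>0, x\<^sub>1, x\<^sub>2, \<dots>\<close>; a monomial is its exponent function.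
  The ring \<open>K[x\<^sub>1, \<dots>, x\<^sub>p]\<close> is the subset \<open>poly_ring p\<close>, because \<open>p\<close> has to be quantified inside
  the definition of an \<open>O\<close>-sequence.
\<close>

type_synonym 'k mpoly = "(nat \<Rightarrow>\<^sub>0 nat) \<Rightarrow>\<^sub>0 'k"

definition mono_deg :: "(nat \<Rightarrow>\<^sub>0 nat) \<Rightarrow> nat" where
  "mono_deg m = (\<Sum>i\<in>Poly_Mapping.keys m. Poly_Mapping.lookup m i)"

definition poly_ring :: "nat \<Rightarrow> 'k::field mpoly set" where
  "poly_ring p = {f. \<forall>m\<in>Poly_Mapping.keys f. Poly_Mapping.keys m \<subseteq> {1..p}}"

definition poly_ring_deg :: "nat \<Rightarrow> nat \<Rightarrow> 'k::field mpoly set" where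
  "poly_ring_deg p t = {f \<in> poly_ring p. \<forall>m\<in>Poly_Mapping.keys f. mono_deg m = t}"

definition hom_component :: "nat \<Rightarrow> 'k::field mpoly \<Rightarrow> 'k mpoly" where
  "hom_component t f =
     (\<Sum>m | m \<in> Poly_Mapping.keys f \<and> mono_deg m = t.
        Poly_Mapping.single m (Poly_Mapping.lookup f m))"

definition poly_ideal :: "nat \<Rightarrow> 'k::field mpoly set \<Rightarrow> bool" where
  "poly_ideal p I \<longleftrightarrow>
     I \<subseteq> poly_ring p \<and> 0 \<in> I \<and> (\<forall>f\<in>I. \<forall>g\<in>I. f + g \<in> I) \<and>
     (\<forall>r\<in>poly_ring p. \<forall>f\<in>I. r * f \<in> I)"

definition homogeneous_ideal :: "nat \<Rightarrow> 'k::field mpoly set \<Rightarrow> bool" where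
  "homogeneous_ideal p I \<longleftrightarrow> poly_ideal p I \<and> (\<forall>f\<in>I. \<forall>t. hom_component t f \<in> I)"

definition poly_scale :: "'k::field \<Rightarrow> 'k mpoly \<Rightarrow> 'k mpoly" where
  "poly_scale c f = Poly_Mapping.single 0 c * f"

interpretation mpoly_vs: vector_space "poly_scale :: 'k::field \<Rightarrow> 'k mpoly \<Rightarrow> 'k mpoly"
  by unfold_locales
    (simp_all add: poly_scale_def algebra_simps single_add mult_single flip: mult.assoc)

text \<open>The subtraction does not truncate: \<open>I\<^sub>t\<close> is a subspace of the finite-dimensional \<open>R\<^sub>t\<close>.\<close>

definition hilbert_function :: "nat \<Rightarrow> 'k::field mpoly set \<Rightarrow> nat \<Rightarrow> nat" where
  "hilbert_function p I t =
     mpoly_vs.dim (poly_ring_deg p t :: 'k mpoly set) - mpoly_vs.dim (I \<inter> poly_ring_deg p t)"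

definition O_sequence :: "'k::field itself \<Rightarrow> (nat \<Rightarrow> nat) \<Rightarrow> bool" where
  "O_sequence K a \<longleftrightarrow>
     (\<exists>p (I :: 'k mpoly set). homogeneous_ideal p I \<and> a = hilbert_function p I)"

definition finite_O_sequence :: "'k::field itself \<Rightarrow> (nat \<Rightarrow> nat) \<Rightarrow> bool" where
  "finite_O_sequence K a \<longleftrightarrow> O_sequence K a \<and> (\<exists>N. \<forall>t\<ge>N. a t = 0)"

definition multiplicity_seq :: "(nat \<Rightarrow> nat) \<Rightarrow> nat" where
  "multiplicity_seq a = (\<Sum>t | a t \<noteq> 0. a t)"

definition num_O_sequences :: "'k::field itself \<Rightarrow> nat \<Rightarrow> nat" where
  "num_O_sequences K d = card {a. finite_O_sequence K a \<and> multiplicity_seq a = d}"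

text \<open>
  The algorithm represents \<open>(a\<^sub>0, \<dots>, a\<^sub>s)\<close> by the list of its entries; the corresponding numerical
  function is its extension by zero. Its own lists are indexed from 1.
\<close>

definition O_sequence_list :: "'k::field itself \<Rightarrow> nat list \<Rightarrow> bool" where
  "O_sequence_list K xs \<longleftrightarrow> O_sequence K (nth_default 0 xs)"

definition at1 :: "'a list \<Rightarrow> nat \<Rightarrow> 'a" where
  "at1 xs i = xs ! (i - 1)"

definition update1 :: "'a list \<Rightarrow> nat \<Rightarrow> 'a \<Rightarrow> 'a list" where
  "update1 xs i x = xs[i - 1 := x]"

record alg_state =
  ctr_d :: nat
  list_O :: "nat list"
  list_A :: "nat list"
  list_B :: "nat list list list"
  ptr_h2 :: nat
  ptr_h1 :: nat
  ptr_h :: nat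

definition alg_init :: alg_state where
  "alg_init =
     \<lparr> ctr_d = 5, list_O = [1, 1, 2, 3], list_A = [0, 0, 1, 1],
       list_B = [[[1, 2]], [[1, 3]], []], ptr_h2 = 1, ptr_h1 = 2, ptr_h = 3 \<rparr>"

definition new_sequences ::
  "'k::field itself \<Rightarrow> nat list list \<Rightarrow> nat list list \<Rightarrow> nat list list" where
  "new_sequences K Bh2 Bh1 =
     filter (O_sequence_list K) (map (\<lambda>a. a @ [2]) Bh2) @
     filter (O_sequence_list K) (map (\<lambda>a. butlast a @ [last a + 1]) Bh1)"

definition alg_step :: "'k::field itself \<Rightarrow> alg_state \<Rightarrow> alg_state" where
  "alg_step K s =
     (let d = ctr_d s;
          B = update1 (list_B s) (ptr_h s)
                (new_sequences K (at1 (list_B s) (ptr_h2 s)) (at1 (list_B s) (ptr_h1 s)));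
          A = list_A s @ [length (at1 B (ptr_h s))];
          Out = list_O s @ [at1 A d + at1 (list_O s) (d - 1)]
      in \<lparr> ctr_d = d + 1, list_O = Out, list_A = A, list_B = B,
           ptr_h2 = ptr_h1 s, ptr_h1 = ptr_h s, ptr_h = ptr_h2 s \<rparr>)"

text \<open>The result is \<open>None\<close> if the loop does not terminate.\<close>

definition OSequences :: "'k::field itself \<Rightarrow> nat \<Rightarrow> nat list option" where
  "OSequences K D =
     map_option list_O (while_option (\<lambda>s. ctr_d s \<le> D) (alg_step K) alg_init)"

end

theory Submission
  imports Defs
begin

text \<open>
  Passing to leading monomials, \<open>O\<close>-sequences over any field are exactly the functions counting, degree
  by degree, a set of monomials that is closed under divisors. Deleting the top-degree monomials, or one
  of them, shows that the last entry of a finite \<open>O\<close>-sequence may be removed or decremented, and an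
  entry \<open>1\<close> in positive degree can only be followed by entries \<open>\<le> 1\<close>. Conversely an entry \<open>1\<close> can always
  be appended: compressing the monomials towards a new variable \<open>y\<close> preserves the counts and
  brings \<open>y\<^sup>s\<close> into the set, after which \<open>y\<^sup>s\<^sup>+\<^sup>1\<close> may be added. So the sequences of multiplicity
  \<open>d\<close> ending in \<open>1\<close> correspond to all sequences of multiplicity \<open>d - 1\<close>, and for \<open>d \<ge> 5\<close> each of the others
  arises exactly once, by appending \<open>2\<close> or incrementing the last entry of a sequence not ending in \<open>1\<close>.
\<close>

subsection \<open>Leading monomials\<close>

text \<open>The linear order on exponent functions serves as the monomial order; what matters is
  that it is total and compatible with addition. \<open>Max\<close> of the empty set is unspecified,
  hence the conditions \<open>f \<noteq> 0\<close> and the sets \<open>V - {0}\<close>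
  below.\<close>

abbreviation lead_mono :: "'k::field mpoly \<Rightarrow> nat \<Rightarrow>\<^sub>0 nat" where
  "lead_mono f \<equiv> Max (Poly_Mapping.keys f)"

lemma lookup_poly_scale [simp]:
  "Poly_Mapping.lookup (poly_scale c f) m = c * Poly_Mapping.lookup f m"
  unfolding poly_scale_def mult_map_scale_conv_mult[symmetric] by (simp add: map.rep_eq when_def)

lemma subspace_lookup_eq_0: "mpoly_vs.subspace {f :: 'k::field mpoly. Poly_Mapping.lookup f m = 0}"
  by (auto simp: mpoly_vs.subspace_def lookup_add)

lemma subspace_keys_subset:
  "mpoly_vs.subspace {f :: 'k::field mpoly. Poly_Mapping.keys f \<subseteq> X}"
  unfolding mpoly_vs.subspace_def
proof (intro conjI ballI allI)
  fix f g :: "'k mpoly" and c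
  assume f: "f \<in> {f. Poly_Mapping.keys f \<subseteq> X}"
  then show "poly_scale c f \<in> {f. Poly_Mapping.keys f \<subseteq> X}"
    by (auto simp: in_keys_iff)
  assume "g \<in> {f. Poly_Mapping.keys f \<subseteq> X}"
  with f show "f + g \<in> {f. Poly_Mapping.keys f \<subseteq> X}"
    using keys_add[of f g] by blast
qed simp

lemma lead_mono_in_keys: "f \<noteq> 0 \<Longrightarrow> lead_mono f \<in> Poly_Mapping.keys f"
  by (rule Max_in) auto

lemma lead_mono_ge: "m \<in> Poly_Mapping.keys f \<Longrightarrow> m \<le> lead_mono f"
  by simp

text \<open>One element of \<open>V\<close> for each leading monomial forms a basis: distinct
  leading monomials force independence, and cancelling leading terms reduces every element of
  \<open>V\<close> to 0.\<close>

lemma dim_eq_card_lead_mono: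
  fixes V :: "'k::field mpoly set"
  assumes X: "finite X" "\<And>f. f \<in> V \<Longrightarrow> Poly_Mapping.keys f \<subseteq> X" and V: "mpoly_vs.subspace V"
  shows "mpoly_vs.dim V = card (lead_mono ` (V - {0}))"
proof -
  define L where "L = lead_mono ` (V - {0})"
  have "\<forall>m\<in>L. \<exists>f. f \<in> V \<and> f \<noteq> 0 \<and> lead_mono f = m"
    unfolding L_def by blast
  then obtain b where b: "b m \<in> V" "b m \<noteq> 0" "lead_mono (b m) = m" if "m \<in> L" for m
    by metis
  have "L \<subseteq> X"
    unfolding L_def using X(2) lead_mono_in_keys by blast
  then have "finite L"
    using X(1) finite_subset by blast
  \<comment> \<open>Monomials are added in increasing order. All earlier basis elements have
    coefficient 0 at the new \<open>m\<close>, hence so does their span, whereas \<open>b m\<close>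
    does not.\<close>
  have "mpoly_vs.independent (b ` L')" if "L' \<subseteq> L" for L'
    using finite_subset[OF that \<open>finite L\<close>] that
  proof (induction L' rule: finite_linorder_max_induct)
    case (insert m L')
    have "Poly_Mapping.lookup (b m') m = 0" if "m' \<in> L'" for m'
    proof (rule ccontr)
      assume "Poly_Mapping.lookup (b m') m \<noteq> 0"
      then have "m \<in> Poly_Mapping.keys (b m')"
        by (simp add: in_keys_iff)
      moreover have "m' \<in> L"
        using that insert.prems by blast
      ultimately have "m \<le> m'"
        using lead_mono_ge[of m "b m'"] b(3) by simp
      with insert.hyps(2) that show False by force
    qed
    then have "mpoly_vs.span (b ` L') \<subseteq> {f. Poly_Mapping.lookup f m = 0}"
      by (intro mpoly_vs.span_minimal subspace_lookup_eq_0) auto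
    moreover have "Poly_Mapping.lookup (b m) m \<noteq> 0"
      using lead_mono_in_keys[of "b m"] b[of m] insert.prems by (auto simp: in_keys_iff)
    ultimately have "b m \<notin> mpoly_vs.span (b ` L')"
      by auto
    with insert show ?case
      by (simp add: mpoly_vs.independent_insertI)
  qed (simp add: mpoly_vs.independent_empty)
  then have ind: "mpoly_vs.independent (b ` L)" by blast
  \<comment> \<open>The measure counts the elements of \<open>X\<close> at or below some monomial of
    \<open>f\<close>. Cancelling the leading term removes at least \<open>m\<close> itself from this
    set, and the measure makes sense for \<open>f = 0\<close> too.\<close>
  have span: "f \<in> mpoly_vs.span (b ` L)" if "f \<in> V" for f
    using that
  proof (induction f rule: measure_induct_rule[of "\<lambda>f. card {x \<in> X. \<exists>k\<in>Poly_Mapping.keys f. x \<le> k}"])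
    case (less f)
    show ?case
    proof (cases "f = 0")
      case False
      define m where "m = lead_mono f"
      have m: "m \<in> L" "m \<in> Poly_Mapping.keys f"
        unfolding m_def L_def using False less.prems lead_mono_in_keys by blast+
      define c where "c = Poly_Mapping.lookup f m / Poly_Mapping.lookup (b m) m"
      define g where "g = f - poly_scale c (b m)"
      have bm: "m \<in> Poly_Mapping.keys (b m)"
        using lead_mono_in_keys[of "b m"] b[OF m(1)] by simp
      have g0: "Poly_Mapping.lookup g m = 0"
        using bm by (simp add: g_def c_def lookup_minus in_keys_iff)
      have "g \<in> V"
        unfolding g_def using V b[OF m(1)] less.prems
        by (intro mpoly_vs.subspace_diff mpoly_vs.subspace_scale)
      have lt: "k < m" if "k \<in> Poly_Mapping.keys g" for k
      proof -
        have "k \<in> Poly_Mapping.keys f \<or> k \<in> Poly_Mapping.keys (b m)"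
          using that by (auto simp: g_def in_keys_iff lookup_minus)
        then have "k \<le> m"
          using lead_mono_ge[of k f] lead_mono_ge[of k "b m"] unfolding b(3)[OF m(1)] m_def[symmetric]
          by blast
        moreover have "k \<noteq> m" using that g0 by (auto simp: in_keys_iff)
        ultimately show ?thesis by simp
      qed
      have "{x \<in> X. \<exists>k\<in>Poly_Mapping.keys g. x \<le> k} \<subset> {x \<in> X. \<exists>k\<in>Poly_Mapping.keys f. x \<le> k}"
      proof
        show "{x \<in> X. \<exists>k\<in>Poly_Mapping.keys g. x \<le> k} \<subseteq> {x \<in> X. \<exists>k\<in>Poly_Mapping.keys f. x \<le> k}"
          using m(2) by (blast intro: order.trans[OF _ less_imp_le[OF lt]])
        have "m \<in> X" using m(1) \<open>L \<subseteq> X\<close> by blast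
        moreover have "\<not> (\<exists>k\<in>Poly_Mapping.keys g. m \<le> k)" using lt by force
        ultimately show "{x \<in> X. \<exists>k\<in>Poly_Mapping.keys g. x \<le> k} \<noteq> {x \<in> X. \<exists>k\<in>Poly_Mapping.keys f. x \<le> k}"
          using m(2) by blast
      qed
      then have "g \<in> mpoly_vs.span (b ` L)"
        using less.IH \<open>g \<in> V\<close> X(1) by (simp add: psubset_card_mono)
      moreover have "poly_scale c (b m) \<in> mpoly_vs.span (b ` L)"
        using m(1) by (intro mpoly_vs.span_scale mpoly_vs.span_base) auto
      ultimately have "g + poly_scale c (b m) \<in> mpoly_vs.span (b ` L)"
        by (rule mpoly_vs.span_add)
      then show ?thesis by (simp add: g_def)
    qed (simp add: mpoly_vs.span_zero)
  qed
  have "inj_on b L"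
    by (rule inj_on_inverseI[of _ lead_mono]) (rule b(3))
  then have "card (b ` L) = card L"
    by (rule card_image)
  moreover have "b ` L \<subseteq> V" "V \<subseteq> mpoly_vs.span (b ` L)"
    using b(1) span by blast+
  ultimately show ?thesis
    unfolding L_def[symmetric] using ind by (blast intro: mpoly_vs.dim_unique)
qed

lemma dim_keys_subset:
  assumes "finite X"
  shows "mpoly_vs.dim {f :: 'k::field mpoly. Poly_Mapping.keys f \<subseteq> X} = card X"
proof -
  have "m \<in> lead_mono ` ({f :: 'k mpoly. Poly_Mapping.keys f \<subseteq> X} - {0})" if "m \<in> X" for m
  proof (rule image_eqI)
    have "Poly_Mapping.keys (Poly_Mapping.single m (1 :: 'k)) = {m}" by simp
    with that show "Poly_Mapping.single m (1 :: 'k) \<in> {f. Poly_Mapping.keys f \<subseteq> X} - {0}"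
      by (metis DiffI empty_not_insert insert_subset empty_subsetI keys_zero mem_Collect_eq singletonD)
  qed simp
  moreover have "lead_mono f \<in> X" if "Poly_Mapping.keys f \<subseteq> X" "f \<noteq> 0" for f :: "'k mpoly"
    using that lead_mono_in_keys by blast
  ultimately have X: "lead_mono ` ({f :: 'k mpoly. Poly_Mapping.keys f \<subseteq> X} - {0}) = X"
    by blast
  have "mpoly_vs.dim {f :: 'k mpoly. Poly_Mapping.keys f \<subseteq> X} =
      card (lead_mono ` ({f :: 'k mpoly. Poly_Mapping.keys f \<subseteq> X} - {0}))"
    by (rule dim_eq_card_lead_mono[OF assms _ subspace_keys_subset]) blast
  then show ?thesis
    unfolding X .
qed

subsection \<open>Hilbert functions and sets of monomials closed under divisors\<close>

definition monomials :: "nat \<Rightarrow> nat \<Rightarrow> (nat \<Rightarrow>\<^sub>0 nat) set" where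
  "monomials p t = {m. Poly_Mapping.keys m \<subseteq> {1..p} \<and> mono_deg m = t}"

text \<open>Monomials are written additively, so \<open>a\<close> divides \<open>a + b\<close>. Such
  a set is the complement of a monomial ideal among the monomials in the first \<open>p\<close>
  variables.\<close>

definition order_ideal :: "nat \<Rightarrow> (nat \<Rightarrow>\<^sub>0 nat) set \<Rightarrow> bool" where
  "order_ideal p M \<longleftrightarrow> (\<forall>a b. a + b \<in> M \<longrightarrow> a \<in> M) \<and> (\<forall>m\<in>M. Poly_Mapping.keys m \<subseteq> {1..p})"

definition layer :: "(nat \<Rightarrow>\<^sub>0 nat) set \<Rightarrow> nat \<Rightarrow> (nat \<Rightarrow>\<^sub>0 nat) set" where
  "layer M t = {m \<in> M. mono_deg m = t}"

lemma mono_deg_superset: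
  "finite S \<Longrightarrow> Poly_Mapping.keys m \<subseteq> S \<Longrightarrow> mono_deg m = (\<Sum>i\<in>S. Poly_Mapping.lookup m i)"
  unfolding mono_deg_def by (rule sum.mono_neutral_left) (auto simp: in_keys_iff)

lemma mono_deg_add: "mono_deg (a + b) = mono_deg a + mono_deg b"
proof -
  have "mono_deg c = (\<Sum>i\<in>Poly_Mapping.keys a \<union> Poly_Mapping.keys b. Poly_Mapping.lookup c i)"
    if "c \<in> {a, b, a + b}" for c
    using that keys_add[of a b] by (intro mono_deg_superset) auto
  then show ?thesis
    by (simp add: lookup_add sum.distrib)
qed

lemma mono_deg_zero [simp]: "mono_deg 0 = 0"
  by (simp add: mono_deg_def)

lemma mono_deg_single [simp]: "mono_deg (Poly_Mapping.single i n) = n"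
  by (simp add: mono_deg_def)

lemma mono_deg_eq_0_iff [simp]: "mono_deg m = 0 \<longleftrightarrow> m = 0"
  by (auto simp: mono_deg_def in_keys_iff intro!: poly_mapping_eqI)

lemma keys_add_nat:
  "Poly_Mapping.keys (a + b :: nat \<Rightarrow>\<^sub>0 nat) = Poly_Mapping.keys a \<union> Poly_Mapping.keys b"
  by (auto simp: in_keys_iff lookup_add)

lemma finite_monomials: "finite (monomials p t)"
proof -
  have "Poly_Mapping.lookup ` monomials p t \<subseteq>
      {f. \<forall>x. (x \<in> {1..p} \<longrightarrow> f x \<in> {..t}) \<and> (x \<notin> {1..p} \<longrightarrow> f x = 0)}"
  proof (rule image_subsetI, rule CollectI, intro allI conjI impI)
    fix m x
    assume m: "m \<in> monomials p t"
    show "Poly_Mapping.lookup m x = 0" if "x \<notin> {1..p}"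
      using m that by (auto simp: monomials_def in_keys_iff)
    show "Poly_Mapping.lookup m x \<in> {..t}"
    proof (cases "x \<in> Poly_Mapping.keys m")
      case True
      then have "Poly_Mapping.lookup m x \<le> mono_deg m"
        unfolding mono_deg_def by (intro member_le_sum) auto
      with m show ?thesis by (simp add: monomials_def)
    qed (simp add: in_keys_iff)
  qed
  then have "finite (Poly_Mapping.lookup ` monomials p t)"
    by (rule finite_subset) (intro finite_set_of_finite_funs; simp)
  then show ?thesis
    by (rule finite_imageD) (simp add: inj_on_def lookup_inject)
qed

lemma layer_eq_Int: "order_ideal p M \<Longrightarrow> layer M t = monomials p t \<inter> M"
  by (auto simp: order_ideal_def layer_def monomials_def)

lemma finite_layer: "order_ideal p M \<Longrightarrow> finite (layer M t)"
  by (simp add: layer_eq_Int finite_monomials)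

lemma monomial_split:
  assumes "i \<in> Poly_Mapping.keys (m :: nat \<Rightarrow>\<^sub>0 nat)"
  obtains n where "m = n + Poly_Mapping.single i 1"
proof
  show "m = (m - Poly_Mapping.single i 1) + Poly_Mapping.single i 1"
    using assms by (auto simp: lookup_add lookup_minus lookup_single when_def in_keys_iff
        intro!: poly_mapping_eqI)
qed

text \<open>Every divisor is reached by removing one variable at a time.\<close>

lemma order_idealI:
  assumes "\<And>m k. m + Poly_Mapping.single k 1 \<in> M \<Longrightarrow> m \<in> M"
    and "\<And>m. m \<in> M \<Longrightarrow> Poly_Mapping.keys m \<subseteq> {1..p}"
  shows "order_ideal p M"
proof -
  have "a \<in> M" if "a + b \<in> M" for a b
    using that
  proof (induction "mono_deg b" arbitrary: b)
    case (Suc n)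
    then have "b \<noteq> 0" by auto
    then obtain k where k: "k \<in> Poly_Mapping.keys b"
      using keys_eq_empty by blast
    obtain b' where b: "b = b' + Poly_Mapping.single k 1"
      using k by (rule monomial_split)
    then have "mono_deg b' = n"
      using Suc.hyps(2) by (simp add: mono_deg_add)
    moreover have "a + b' \<in> M"
      using Suc.prems assms(1)[of "a + b'" k] by (simp add: b add.assoc)
    ultimately show ?case
      using Suc.hyps(1) by blast
  qed simp
  with assms(2) show ?thesis
    by (auto simp: order_ideal_def)
qed

lemma poly_ring_deg_eq: "poly_ring_deg p t = {f. Poly_Mapping.keys f \<subseteq> monomials p t}"
  by (auto simp: poly_ring_deg_def poly_ring_def monomials_def)

lemma dim_poly_ring_deg:
  "mpoly_vs.dim (poly_ring_deg p t :: 'k::field mpoly set) = card (monomials p t)"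
  unfolding poly_ring_deg_eq by (rule dim_keys_subset[OF finite_monomials])

lemma keys_single_mult:
  fixes f :: "'k::field mpoly"
  shows "Poly_Mapping.keys (Poly_Mapping.single b 1 * f) = (+) b ` Poly_Mapping.keys f"
proof
  show "Poly_Mapping.keys (Poly_Mapping.single b 1 * f) \<subseteq> (+) b ` Poly_Mapping.keys f"
    using keys_mult[of "Poly_Mapping.single b 1" f] by auto
  have "Poly_Mapping.lookup (Poly_Mapping.single b 1 * f) (b + m) = Poly_Mapping.lookup f m" for m
    by (simp add: lookup_mult lookup_single when_mult eq_commute[of b])
  then show "(+) b ` Poly_Mapping.keys f \<subseteq> Poly_Mapping.keys (Poly_Mapping.single b 1 * f)"
    by (auto simp: in_keys_iff)
qed

text \<open>Translation by \<open>b\<close> is monotone for the monomial order and therefore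
  commutes with \<open>Max\<close>.\<close>

lemma lead_mono_single_mult:
  fixes f :: "'k::field mpoly"
  assumes "f \<noteq> 0"
  shows "lead_mono (Poly_Mapping.single b 1 * f) = b + lead_mono f"
  unfolding keys_single_mult using assms
  by (intro mono_Max_commute[symmetric]) (auto simp: mono_def add_left_mono)

text \<open>\<open>M\<close> collects the standard monomials, those that are not leading monomials
  of homogeneous elements of \<open>I\<close>. It is closed under divisors because a multiple of a
  leading monomial is again one.\<close>

lemma homogeneous_ideal_imp_order_ideal:
  fixes I :: "'k::field mpoly set"
  assumes "homogeneous_ideal p I"
  obtains M where "order_ideal p M" "\<And>t. hilbert_function p I t = card (layer M t)"
proof
  have I: "0 \<in> I" "\<And>f g. f \<in> I \<Longrightarrow> g \<in> I \<Longrightarrow> f + g \<in> I"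
    "\<And>r f. r \<in> poly_ring p \<Longrightarrow> f \<in> I \<Longrightarrow> r * f \<in> I"
    using assms by (auto simp: homogeneous_ideal_def poly_ideal_def)
  define L where "L t = lead_mono ` (I \<inter> poly_ring_deg p t - {0})" for t
  define M where "M = {m. Poly_Mapping.keys m \<subseteq> {1..p} \<and> m \<notin> L (mono_deg m)}"
  have L: "L t \<subseteq> monomials p t" for t
    unfolding L_def poly_ring_deg_eq using lead_mono_in_keys by blast
  moreover have "finite (L t)" for t
    using L finite_monomials by (rule finite_subset)
  moreover have "layer M t = monomials p t - L t" for t
    by (auto simp: layer_def M_def monomials_def)
  moreover have "mpoly_vs.dim (I \<inter> poly_ring_deg p t) = card (L t)" for t
    unfolding L_def
  proof (rule dim_eq_card_lead_mono[OF finite_monomials])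
    \<comment> \<open>Scaling is multiplication by a constant polynomial, so the ideal is a
      subspace.\<close>
    have "mpoly_vs.subspace I"
      using I by (auto simp: mpoly_vs.subspace_def poly_scale_def poly_ring_def)
    then show "mpoly_vs.subspace (I \<inter> poly_ring_deg p t)"
      by (simp add: poly_ring_deg_eq subspace_keys_subset mpoly_vs.subspace_inter)
  qed (auto simp: poly_ring_deg_eq)
  ultimately show "hilbert_function p I t = card (layer M t)" for t
    by (simp add: hilbert_function_def dim_poly_ring_deg card_Diff_subset)
  show "order_ideal p M"
    unfolding order_ideal_def
  proof (intro conjI allI impI ballI)
    fix a b
    assume ab: "a + b \<in> M"
    have keys: "Poly_Mapping.keys a \<subseteq> {1..p}" "Poly_Mapping.keys b \<subseteq> {1..p}"
      using ab by (auto simp: M_def keys_add_nat)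
    show "a \<in> M"
    proof (rule ccontr)
      assume "a \<notin> M"
      then obtain f where f: "f \<in> I" "f \<in> poly_ring_deg p (mono_deg a)" "f \<noteq> 0" "a = lead_mono f"
        using keys by (auto simp: M_def L_def)
      let ?g = "Poly_Mapping.single b 1 * f"
      have "?g \<in> I"
        using f(1) keys by (intro I(3)) (auto simp: poly_ring_def)
      moreover have "?g \<in> poly_ring_deg p (mono_deg (a + b))"
        using f(2) keys
        by (fastforce simp: poly_ring_deg_eq keys_single_mult monomials_def keys_add_nat mono_deg_add)
      moreover have "?g \<noteq> 0"
        using f(3) by (simp flip: keys_eq_empty add: keys_single_mult)
      moreover have "lead_mono ?g = a + b"
        using f(3,4) by (simp add: lead_mono_single_mult add.commute)
      ultimately have "a + b \<in> L (mono_deg (a + b))"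
        unfolding L_def by (intro image_eqI[of _ _ ?g]) auto
      with ab show False by (simp add: M_def)
    qed
  qed (auto simp: M_def)
qed

lemma keys_hom_component: "Poly_Mapping.keys (hom_component t f) \<subseteq> Poly_Mapping.keys f"
  unfolding hom_component_def by (rule order.trans[OF keys_sum]) auto

text \<open>The witness is the monomial ideal spanned by the monomials outside \<open>M\<close>. It
  absorbs products because a product of monomials lying in \<open>M\<close> has both factors in
  \<open>M\<close>.\<close>

lemma order_ideal_imp_homogeneous_ideal:
  assumes M: "order_ideal p M"
  obtains I :: "'k::field mpoly set"
  where "homogeneous_ideal p I" "\<And>t. hilbert_function p I t = card (layer M t)"
proof
  define I :: "'k mpoly set" where "I = {f \<in> poly_ring p. Poly_Mapping.keys f \<inter> M = {}}"
  have "r * f \<in> I" if "r \<in> poly_ring p" "f \<in> I" for r f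
  proof -
    have "k \<notin> M \<and> Poly_Mapping.keys k \<subseteq> {1..p}" if k: "k \<in> Poly_Mapping.keys (r * f)" for k
    proof -
      obtain a b where "k = a + b" "a \<in> Poly_Mapping.keys r" "b \<in> Poly_Mapping.keys f"
        using keys_mult[of r f] k by blast
      with \<open>r \<in> poly_ring p\<close> \<open>f \<in> I\<close> M show ?thesis
        by (auto simp: I_def order_ideal_def poly_ring_def keys_add_nat add.commute[of a])
    qed
    then show ?thesis
      by (auto simp: I_def poly_ring_def)
  qed
  moreover have "f + g \<in> I" if "f \<in> I" "g \<in> I" for f g
    using that keys_add[of f g] by (fastforce simp: I_def poly_ring_def)
  moreover have "hom_component t f \<in> I" if "f \<in> I" for t f
    using that keys_hom_component[of t f] by (fastforce simp: I_def poly_ring_def)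
  moreover have "I \<subseteq> poly_ring p" "0 \<in> I"
    by (auto simp: I_def poly_ring_def)
  ultimately show "homogeneous_ideal p I"
    by (auto simp: homogeneous_ideal_def poly_ideal_def)
  fix t
  have "I \<inter> poly_ring_deg p t = {f. Poly_Mapping.keys f \<subseteq> monomials p t - M}"
    by (auto simp: I_def poly_ring_deg_def poly_ring_def monomials_def)
  then have "mpoly_vs.dim (I \<inter> poly_ring_deg p t) = card (monomials p t - M)"
    by (simp add: dim_keys_subset finite_monomials)
  moreover have "card (monomials p t) = card (monomials p t \<inter> M) + card (monomials p t - M)"
    by (rule card_Int_Diff[OF finite_monomials])
  ultimately show "hilbert_function p I t = card (layer M t)"
    by (simp add: hilbert_function_def dim_poly_ring_deg layer_eq_Int[OF M])
qed

text \<open>The right-hand side no longer mentions the field; the rest of the argument is purely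
  combinatorial.\<close>

lemma O_sequence_iff_order_ideal:
  "O_sequence TYPE('k::field) a \<longleftrightarrow> (\<exists>p M. order_ideal p M \<and> a = (\<lambda>t. card (layer M t)))"
proof
  assume "O_sequence TYPE('k) a"
  then obtain p and I :: "'k mpoly set" where "homogeneous_ideal p I" "a = hilbert_function p I"
    by (auto simp: O_sequence_def)
  then show "\<exists>p M. order_ideal p M \<and> a = (\<lambda>t. card (layer M t))"
    by (elim homogeneous_ideal_imp_order_ideal) (auto simp: fun_eq_iff)
next
  assume "\<exists>p M. order_ideal p M \<and> a = (\<lambda>t. card (layer M t))"
  then obtain p M where "order_ideal p M" "a = (\<lambda>t. card (layer M t))" by blast
  moreover from this(1) obtain I :: "'k mpoly set"
    where "homogeneous_ideal p I" "\<And>t. hilbert_function p I t = card (layer M t)"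
    by (rule order_ideal_imp_homogeneous_ideal) blast
  ultimately have "a = hilbert_function p I"
    by (simp add: fun_eq_iff)
  with \<open>homogeneous_ideal p I\<close> show "O_sequence TYPE('k) a"
    by (auto simp: O_sequence_def)
qed

subsection \<open>Compression\<close>

text \<open>
  \<open>exchange i j m b\<close> runs over the monomials that differ from \<open>m\<close> only in how its degree in \<open>x\<^sub>i, x\<^sub>j\<close> is
  split, \<open>b\<close> being the exponent of \<open>x\<^sub>j\<close>; the subtraction truncates if \<open>b\<close> exceeds that degree.
  Compression replaces the elements of \<open>M\<close> on each such line by equally many with the
  least exponents of \<open>x\<^sub>j\<close>.
\<close>

definition exchange :: "nat \<Rightarrow> nat \<Rightarrow> (nat \<Rightarrow>\<^sub>0 nat) \<Rightarrow> nat \<Rightarrow> nat \<Rightarrow>\<^sub>0 nat" where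
  "exchange i j m b =
     Poly_Mapping.update j b
       (Poly_Mapping.update i (Poly_Mapping.lookup m i + Poly_Mapping.lookup m j - b) m)"

definition line_exponents :: "nat \<Rightarrow> nat \<Rightarrow> (nat \<Rightarrow>\<^sub>0 nat) set \<Rightarrow> (nat \<Rightarrow>\<^sub>0 nat) \<Rightarrow> nat set" where
  "line_exponents i j M m =
     {b. b \<le> Poly_Mapping.lookup m i + Poly_Mapping.lookup m j \<and> exchange i j m b \<in> M}"

definition compress :: "nat \<Rightarrow> nat \<Rightarrow> (nat \<Rightarrow>\<^sub>0 nat) set \<Rightarrow> (nat \<Rightarrow>\<^sub>0 nat) set" where
  "compress i j M = {m. Poly_Mapping.lookup m j < card (line_exponents i j M m)}"

lemma finite_line_exponents [simp]: "finite (line_exponents i j M m)"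
  by (simp add: line_exponents_def)

lemma lookup_exchange:
  "i \<noteq> j \<Longrightarrow> Poly_Mapping.lookup (exchange i j m b) k =
     (if k = j then b else if k = i then Poly_Mapping.lookup m i + Poly_Mapping.lookup m j - b
      else Poly_Mapping.lookup m k)"
  by (simp add: exchange_def lookup_update)

lemma exchange_self: "i \<noteq> j \<Longrightarrow> exchange i j m (Poly_Mapping.lookup m j) = m"
  by (rule poly_mapping_eqI) (simp add: lookup_exchange)

text \<open>The bound on \<open>b\<close> keeps the subtraction exact, so \<open>m\<close> and
  \<open>exchange i j m b\<close> lie on the same line.\<close>

lemma exchange_exchange:
  "i \<noteq> j \<Longrightarrow> b \<le> Poly_Mapping.lookup m i + Poly_Mapping.lookup m j \<Longrightarrow>
     exchange i j (exchange i j m b) c = exchange i j m c"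
  by (rule poly_mapping_eqI) (simp add: lookup_exchange)

lemma line_exponents_exchange:
  "i \<noteq> j \<Longrightarrow> b \<le> Poly_Mapping.lookup m i + Poly_Mapping.lookup m j \<Longrightarrow>
     line_exponents i j M (exchange i j m b) = line_exponents i j M m"
  by (simp add: line_exponents_def exchange_exchange lookup_exchange)

lemma exchange_in_compress_iff:
  "i \<noteq> j \<Longrightarrow> b \<le> Poly_Mapping.lookup m i + Poly_Mapping.lookup m j \<Longrightarrow>
     exchange i j m b \<in> compress i j M \<longleftrightarrow> b < card (line_exponents i j M m)"
  by (simp add: compress_def line_exponents_exchange lookup_exchange)

text \<open>The line through \<open>m\<close> meets \<open>M\<close>, so its compressed version
  contains at least the monomial with exponent 0.\<close>

lemma exchange_0_in_compress: "i \<noteq> j \<Longrightarrow> m \<in> M \<Longrightarrow> exchange i j m 0 \<in> compress i j M"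
  by (auto simp: exchange_in_compress_iff card_gt_0_iff line_exponents_def exchange_self
      intro!: exI[of _ "Poly_Mapping.lookup m j"])

lemma keys_exchange: "i \<noteq> j \<Longrightarrow> Poly_Mapping.keys (exchange i j m b) \<subseteq> Poly_Mapping.keys m \<union> {i, j}"
  by (auto simp: in_keys_iff lookup_exchange split: if_splits)

lemma mono_deg_exchange:
  assumes "i \<noteq> j" "b \<le> Poly_Mapping.lookup m i + Poly_Mapping.lookup m j"
  shows "mono_deg (exchange i j m b) = mono_deg m"
proof -
  define S where "S = Poly_Mapping.keys m - {i, j}"
  have deg: "mono_deg n = Poly_Mapping.lookup n i + Poly_Mapping.lookup n j + (\<Sum>k\<in>S. Poly_Mapping.lookup n k)"
    if "Poly_Mapping.keys n \<subseteq> Poly_Mapping.keys m \<union> {i, j}" for n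
  proof -
    have "mono_deg n = (\<Sum>k\<in>insert i (insert j S). Poly_Mapping.lookup n k)"
      using that by (intro mono_deg_superset) (auto simp: S_def)
    also have "\<dots> = Poly_Mapping.lookup n i + Poly_Mapping.lookup n j + (\<Sum>k\<in>S. Poly_Mapping.lookup n k)"
      using assms(1) by (simp add: S_def)
    finally show ?thesis .
  qed
  have "(\<Sum>k\<in>S. Poly_Mapping.lookup (exchange i j m b) k) = (\<Sum>k\<in>S. Poly_Mapping.lookup m k)"
    by (rule sum.cong) (auto simp: S_def lookup_exchange assms(1))
  moreover have "mono_deg m = Poly_Mapping.lookup m i + Poly_Mapping.lookup m j + (\<Sum>k\<in>S. Poly_Mapping.lookup m k)"
    by (rule deg) blast
  ultimately show ?thesis
    using assms by (simp only: deg[OF keys_exchange[OF assms(1)]]) (simp add: lookup_exchange)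
qed

text \<open>Dividing by a variable other than \<open>x_i\<close>, \<open>x_j\<close> carries one
  line to another of the same length, and the exponent set can only grow. Dividing by
  \<open>x_i\<close> or \<open>x_j\<close> shortens the line by one, and the count then drops only
  if the longer line lies entirely in \<open>M\<close>.\<close>

lemma order_ideal_compress:
  assumes M: "order_ideal p M" and ij: "i \<noteq> j" "i \<in> {1..p}" "j \<in> {1..p}"
  shows "order_ideal p (compress i j M)"
proof (rule order_idealI)
  fix m
  assume "m \<in> compress i j M"
  then have "line_exponents i j M m \<noteq> {}"
    by (auto simp: compress_def)
  then obtain b where "exchange i j m b \<in> M"
    by (auto simp: line_exponents_def)
  then have keys: "Poly_Mapping.keys (exchange i j m b) \<subseteq> {1..p}"
    using M by (auto simp: order_ideal_def)
  show "Poly_Mapping.keys m \<subseteq> {1..p}"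
  proof
    fix k assume k: "k \<in> Poly_Mapping.keys m"
    show "k \<in> {1..p}"
    proof (cases "k = i \<or> k = j")
      case False
      with k have "k \<in> Poly_Mapping.keys (exchange i j m b)"
        using ij(1) by (simp add: in_keys_iff lookup_exchange)
      with keys show ?thesis by blast
    qed (use ij in blast)
  qed
next
  fix m :: "nat \<Rightarrow>\<^sub>0 nat" and k
  let ?m' = "m + Poly_Mapping.single k 1"
  assume "?m' \<in> compress i j M"
  then have less: "Poly_Mapping.lookup ?m' j < card (line_exponents i j M ?m')"
    by (simp add: compress_def)
  have down: "a \<in> M" if "a + b \<in> M" for a b
    using M that by (auto simp: order_ideal_def)
  show "m \<in> compress i j M"
  proof (cases "k = i \<or> k = j")
    case False
    then have "exchange i j ?m' b = exchange i j m b + Poly_Mapping.single k 1" for b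
      using ij by (intro poly_mapping_eqI) (auto simp: lookup_exchange lookup_add lookup_single when_def)
    then have "line_exponents i j M ?m' \<subseteq> line_exponents i j M m"
      using False by (auto simp: line_exponents_def lookup_add lookup_single when_def dest: down)
    then have "card (line_exponents i j M ?m') \<le> card (line_exponents i j M m)"
      by (simp add: card_mono)
    with less show ?thesis
      by (simp add: compress_def lookup_add)
  next
    case True
    define d where "d = Poly_Mapping.lookup m i + Poly_Mapping.lookup m j"
    define T where "T = line_exponents i j M ?m'"
    have sum: "Poly_Mapping.lookup ?m' i + Poly_Mapping.lookup ?m' j = Suc d"
      using True ij by (auto simp: d_def lookup_add lookup_single when_def)
    have T: "b \<in> T \<longleftrightarrow> b \<le> Suc d \<and> exchange i j ?m' b \<in> M" for b
      unfolding T_def line_exponents_def sum by simp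
    have S: "b \<in> line_exponents i j M m \<longleftrightarrow> b \<le> d \<and> exchange i j m b \<in> M" for b
      by (simp add: line_exponents_def d_def)
    \<comment> \<open>Whichever of the two variables \<open>k\<close> is, elements of the line of
      \<open>?m'\<close> descend to the line of \<open>m\<close> in two ways: dividing by
      \<open>x_i\<close> keeps the exponent \<open>b\<close>, and dividing by \<open>x_j\<close>
      lowers it by one (\<open>shift\<close>).\<close>
    have keep: "b \<in> line_exponents i j M m" if "b \<in> T" "b \<le> d" for b
    proof -
      have "exchange i j ?m' b = exchange i j m b + Poly_Mapping.single i 1"
        using ij True that(2) sum
        by (intro poly_mapping_eqI)
          (auto simp: lookup_exchange lookup_add lookup_single when_def d_def)
      with that show ?thesis by (auto simp: T S dest: down)
    qed
    have shift: "b \<in> line_exponents i j M m" if "Suc b \<in> T" for b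
    proof -
      have "exchange i j ?m' (Suc b) = exchange i j m b + Poly_Mapping.single j 1"
        using ij True that sum
        by (intro poly_mapping_eqI)
          (auto simp: lookup_exchange lookup_add lookup_single when_def d_def T)
      with that show ?thesis by (auto simp: T S dest: down)
    qed
    \<comment> \<open>If \<open>b0\<close> is missing from \<open>T\<close>, shifting the elements above \<open>b0\<close> down by one embeds \<open>T\<close>.\<close>
    have "min (card T) (Suc d) \<le> card (line_exponents i j M m)"
    proof (cases "{..Suc d} \<subseteq> T")
      case True
      then have "{..d} \<subseteq> line_exponents i j M m"
        by (auto intro!: keep subsetD[OF True])
      from card_mono[OF _ this] show ?thesis by simp
    next
      case False
      then obtain b0 where b0: "b0 \<le> Suc d" "b0 \<notin> T" by auto
      define f where "f b = (if b < b0 then b else b - 1)" for b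
      have "f b \<in> line_exponents i j M m" if "b \<in> T" for b
      proof (cases "b < b0")
        case True
        with that b0 show ?thesis by (auto simp: f_def intro: keep)
      next
        case False
        with that b0 have "b > b0" by (metis linorder_neqE_nat)
        with that show ?thesis by (cases b) (auto simp: f_def intro: shift)
      qed
      moreover have "inj_on f T"
      proof (rule inj_onI)
        fix x y assume "x \<in> T" "y \<in> T" "f x = f y"
        moreover from this b0 have "x \<noteq> b0" "y \<noteq> b0" by auto
        ultimately show "x = y" by (auto simp: f_def split: if_splits)
      qed
      ultimately have "card T \<le> card (line_exponents i j M m)"
        by (intro card_inj_on_le[of f]) auto
      then show ?thesis by simp
    qed
    \<comment> \<open>The cap \<open>Suc d\<close> does no harm, because the exponent of
      \<open>x_j\<close> in \<open>m\<close> is at most \<open>d\<close>.\<close>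
    moreover have "Poly_Mapping.lookup m j < min (card T) (Suc d)"
      using less by (auto simp: T_def d_def lookup_add)
    ultimately show ?thesis
      unfolding compress_def mem_Collect_eq by linarith
  qed
qed

text \<open>Counting is done line by line: compression keeps the number of elements on every line,
  and lines stay within one degree.\<close>

lemma card_layer_compress:
  assumes M: "order_ideal p M" and ij: "i \<noteq> j" "i \<in> {1..p}" "j \<in> {1..p}"
  shows "card (layer (compress i j M) t) = card (layer M t)"
proof -
  \<comment> \<open>Each line in degree \<open>t\<close> is represented by its unique monomial free
    of \<open>x_j\<close>; a monomial then corresponds to its line together with its exponent of
    \<open>x_j\<close>.\<close>
  define R where "R = {m \<in> monomials p t. Poly_Mapping.lookup m j = 0}"
  have "finite R"
    by (simp add: R_def finite_monomials)
  have count: "card (layer N t) = (\<Sum>r\<in>R. card (line_exponents i j N r))" if N: "order_ideal p N" for N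
  proof -
    have "bij_betw (\<lambda>m. (exchange i j m 0, Poly_Mapping.lookup m j))
        (layer N t) (SIGMA r:R. line_exponents i j N r)"
    proof (rule bij_betw_byWitness[where f' = "\<lambda>(r, b). exchange i j r b"])
      show "\<forall>m\<in>layer N t. (\<lambda>(r, b). exchange i j r b) (exchange i j m 0, Poly_Mapping.lookup m j) = m"
        using ij by (simp add: exchange_exchange exchange_self)
      show "\<forall>x\<in>SIGMA r:R. line_exponents i j N r.
          (exchange i j ((\<lambda>(r, b). exchange i j r b) x) 0,
           Poly_Mapping.lookup ((\<lambda>(r, b). exchange i j r b) x) j) = x"
      proof (clarify, rule conjI)
        fix r b assume r: "r \<in> R" and b: "b \<in> line_exponents i j N r"
        have "exchange i j (exchange i j r b) 0 = exchange i j r 0"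
          using b ij by (simp add: line_exponents_def exchange_exchange)
        also have "\<dots> = r"
          using r exchange_self[OF ij(1), of r] by (simp add: R_def)
        finally show "exchange i j (exchange i j r b) 0 = r" .
        show "Poly_Mapping.lookup (exchange i j r b) j = b"
          using ij by (simp add: lookup_exchange)
      qed
      show "(\<lambda>m. (exchange i j m 0, Poly_Mapping.lookup m j)) ` layer N t \<subseteq> (SIGMA r:R. line_exponents i j N r)"
      proof (rule image_subsetI)
        fix m assume m: "m \<in> layer N t"
        then have "Poly_Mapping.keys m \<subseteq> {1..p}"
          using N by (auto simp: layer_def order_ideal_def)
        then have "Poly_Mapping.keys (exchange i j m 0) \<subseteq> {1..p}"
          using keys_exchange[OF ij(1), of m 0] ij by blast
        then have "exchange i j m 0 \<in> R"
          using m ij by (simp add: R_def layer_def monomials_def mono_deg_exchange lookup_exchange)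
        moreover have "Poly_Mapping.lookup m j \<in> line_exponents i j N (exchange i j m 0)"
          using m ij by (simp add: line_exponents_exchange) (simp add: line_exponents_def exchange_self layer_def)
        ultimately show "(exchange i j m 0, Poly_Mapping.lookup m j) \<in> (SIGMA r:R. line_exponents i j N r)"
          by simp
      qed
      show "(\<lambda>(r, b). exchange i j r b) ` (SIGMA r:R. line_exponents i j N r) \<subseteq> layer N t"
        using ij by (auto simp: R_def line_exponents_def layer_def monomials_def mono_deg_exchange)
    qed
    then show ?thesis
      using \<open>finite R\<close> by (simp add: bij_betw_same_card card_SigmaI)
  qed
  have "card (line_exponents i j (compress i j M) r) = card (line_exponents i j M r)" for r
  proof -
    let ?d = "Poly_Mapping.lookup r i + Poly_Mapping.lookup r j"
    \<comment> \<open>The line has only \<open>?d + 1\<close> points, so the initial segment of the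
      prescribed length fits on it.\<close>
    have "card (line_exponents i j M r) \<le> card {..?d}"
      by (rule card_mono) (auto simp: line_exponents_def)
    then have le: "card (line_exponents i j M r) \<le> Suc ?d" by simp
    have "line_exponents i j (compress i j M) r = {b. b \<le> ?d \<and> b < card (line_exponents i j M r)}"
      unfolding line_exponents_def[of i j "compress i j M"] using exchange_in_compress_iff[OF ij(1)] by blast
    also have "\<dots> = {..<card (line_exponents i j M r)}"
      using le by (auto simp del: finite_line_exponents)
    finally show ?thesis by simp
  qed
  with count[OF M] count[OF order_ideal_compress[OF M ij]] show ?thesis
    by simp
qed

text \<open>
  Compress towards the fresh variable \<open>x\<^bsub>p+1\<^esub>\<close> against \<open>x\<^sub>1, \<dots>, x\<^sub>p\<close> in turn: each step clears one more
  variable from some monomial of degree \<open>s\<close>.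
\<close>

lemma exists_order_ideal_single:
  assumes "order_ideal p M" "layer M s \<noteq> {}"
  obtains N where "order_ideal (Suc p) N" "\<And>t. card (layer N t) = card (layer M t)"
    "Poly_Mapping.single (Suc p) s \<in> N"
proof -
  have "\<exists>N. order_ideal (Suc p) N \<and> (\<forall>t. card (layer N t) = card (layer M t)) \<and>
      (\<exists>m\<in>layer N s. Poly_Mapping.keys m \<inter> {1..q} = {})" if "q \<le> p" for q
    using that
  proof (induction q)
    case 0
    have "order_ideal (Suc p) M"
      using assms(1) by (force simp: order_ideal_def)
    with assms(2) show ?case by (auto intro!: exI[of _ M])
  next
    case (Suc q)
    then obtain N m where N: "order_ideal (Suc p) N" "\<And>t. card (layer N t) = card (layer M t)"
      and m: "m \<in> layer N s" "Poly_Mapping.keys m \<inter> {1..q} = {}"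
      by auto
    let ?i = "Suc p" and ?j = "Suc q"
    have ij: "?i \<noteq> ?j" "?i \<in> {1..Suc p}" "?j \<in> {1..Suc p}"
      using Suc.prems by auto
    \<comment> \<open>Exponent 0 moves the whole degree in \<open>x_(q+1)\<close> to the fresh
      variable, and the variables cleared earlier stay untouched.\<close>
    have "exchange ?i ?j m 0 \<in> layer (compress ?i ?j N) s"
      using m(1) ij(1) by (simp add: layer_def exchange_0_in_compress mono_deg_exchange)
    moreover have "Poly_Mapping.keys (exchange ?i ?j m 0) \<inter> {1..Suc q} = {}"
      using m(2) ij(1) Suc.prems
      by (auto simp: disjoint_iff in_keys_iff lookup_exchange le_Suc_eq split: if_splits)
    ultimately show ?case
      using order_ideal_compress[OF N(1) ij] card_layer_compress[OF N(1) ij] N(2)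
      by (intro exI[of _ "compress ?i ?j N"]) auto
  qed
  then obtain N m where N: "order_ideal (Suc p) N" "\<And>t. card (layer N t) = card (layer M t)"
    and m: "m \<in> layer N s" "Poly_Mapping.keys m \<inter> {1..p} = {}"
    by (metis order_refl)
  have "Poly_Mapping.keys m \<subseteq> {1..Suc p}"
    using N(1) m(1) by (auto simp: order_ideal_def layer_def)
  with m(2) have keys: "Poly_Mapping.keys m \<subseteq> {Suc p}"
    by (force simp: le_Suc_eq)
  then have "mono_deg m = Poly_Mapping.lookup m (Suc p)"
    by (subst mono_deg_superset[of "{Suc p}"]) auto
  then have "m = Poly_Mapping.single (Suc p) s"
    using keys m(1) by (intro poly_mapping_eqI)
      (auto simp: layer_def lookup_single when_def in_keys_iff subset_iff)
  with m(1) N show thesis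
    by (intro that[of N]) (auto simp: layer_def)
qed

subsection \<open>Modifying the last entry of an \<open>O\<close>-sequence\<close>

lemma O_sequenceE:
  assumes "O_sequence TYPE('k::field) a"
  obtains p M where "order_ideal p M" "\<And>t. a t = card (layer M t)"
  using assms by (auto simp: O_sequence_iff_order_ideal)

lemma O_sequenceI:
  assumes "order_ideal p M" "\<And>t. a t = card (layer M t)"
  shows "O_sequence TYPE('k::field) a"
  using assms by (auto simp: O_sequence_iff_order_ideal fun_eq_iff)

lemma order_ideal_downward: "order_ideal p M \<Longrightarrow> a + b \<in> M \<Longrightarrow> a \<in> M"
  by (auto simp: order_ideal_def)

lemma layer_eq_empty: "order_ideal p M \<Longrightarrow> card (layer M t) = 0 \<Longrightarrow> m \<in> M \<Longrightarrow> mono_deg m \<noteq> t"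
  using finite_layer by (fastforce simp: layer_def)

lemma O_sequence_0_le: "O_sequence TYPE('k::field) a \<Longrightarrow> a 0 \<le> 1"
proof (erule O_sequenceE)
  fix p M assume a: "\<And>t. a t = card (layer M t)"
  have "card (layer M 0) \<le> card {0 :: nat \<Rightarrow>\<^sub>0 nat}"
    by (rule card_mono) (auto simp: layer_def)
  then show "a 0 \<le> 1" by (simp add: a)
qed

text \<open>A monomial of degree \<open>t + 1\<close> has a divisor of degree
  \<open>t\<close>.\<close>

lemma O_sequence_Suc_eq_0:
  assumes "O_sequence TYPE('k::field) a" "a t = 0"
  shows "a (Suc t) = 0"
  using assms(1)
proof (rule O_sequenceE)
  fix p M assume M: "order_ideal p M" and a: "\<And>t. a t = card (layer M t)"
  have "mono_deg m \<noteq> Suc t" if "m \<in> M" for m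
  proof
    assume deg: "mono_deg m = Suc t"
    then have "m \<noteq> 0" by auto
    then obtain i where "i \<in> Poly_Mapping.keys m"
      using keys_eq_empty by blast
    then obtain n where n: "m = n + Poly_Mapping.single i 1"
      by (rule monomial_split)
    then have "mono_deg n = t" "n \<in> M"
      using deg that order_ideal_downward[OF M] by (auto simp: mono_deg_add)
    with layer_eq_empty[OF M] assms(2) a show False by metis
  qed
  then have "layer M (Suc t) = {}"
    by (auto simp: layer_def)
  then show "a (Suc t) = 0"
    by (simp add: a)
qed

text \<open>Let \<open>u\<close> be the only monomial of degree \<open>t\<close>. Dividing a
  monomial of degree \<open>t + 1\<close> by any of its variables gives \<open>u\<close>, so it
  contains just one variable. Since \<open>t > 0\<close>, this is the variable of \<open>u\<close>,
  which leaves a single candidate.\<close>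

lemma O_sequence_Suc_le_1:
  assumes "O_sequence TYPE('k::field) a" "a t = 1" "t > 0"
  shows "a (Suc t) \<le> 1"
  using assms(1)
proof (rule O_sequenceE)
  fix p M assume M: "order_ideal p M" and a: "\<And>t. a t = card (layer M t)"
  then obtain u where u: "layer M t = {u}"
    using assms(2) by (metis card_1_singletonE)
  have pred: "n = u" if "n + Poly_Mapping.single i 1 \<in> layer M (Suc t)" for n i
  proof -
    have "n \<in> layer M t"
      using that order_ideal_downward[OF M] by (auto simp: layer_def mono_deg_add)
    with u show ?thesis by blast
  qed
  have pure: "\<exists>i. m = u + Poly_Mapping.single i 1 \<and> Poly_Mapping.keys u = {i}"
    if m: "m \<in> layer M (Suc t)" for m
  proof -
    have "m \<noteq> 0" using m by (auto simp: layer_def)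
    then obtain i where i: "i \<in> Poly_Mapping.keys m"
      using keys_eq_empty by blast
    then have mi: "m = u + Poly_Mapping.single i 1"
      using monomial_split pred m by metis
    have "j = i" if "j \<in> Poly_Mapping.keys m" for j
    proof -
      have "m = u + Poly_Mapping.single j 1"
        using monomial_split[OF that] pred m by metis
      with mi have "Poly_Mapping.lookup (Poly_Mapping.single i (1::nat)) j
          = Poly_Mapping.lookup (Poly_Mapping.single j 1) j"
        by simp
      then show ?thesis by (simp add: lookup_single when_def split: if_splits)
    qed
    then have "Poly_Mapping.keys u \<subseteq> {i}"
      using mi by (auto simp: keys_add_nat)
    moreover have "Poly_Mapping.keys u \<noteq> {}"
    proof
      assume "Poly_Mapping.keys u = {}"
      then have "mono_deg u = 0" by simp
      moreover have "mono_deg u = t" using u by (auto simp: layer_def)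
      ultimately show False using \<open>t > 0\<close> by simp
    qed
    ultimately have "Poly_Mapping.keys u = {i}" by blast
    with mi show ?thesis by blast
  qed
  have "m = n" if "m \<in> layer M (Suc t)" "n \<in> layer M (Suc t)" for m n
    using pure[OF that(1)] pure[OF that(2)] by auto
  then have "card (layer M (Suc t)) \<le> 1"
    by (simp add: card_le_Suc0_iff_eq finite_layer[OF M])
  then show "a (Suc t) \<le> 1" by (simp add: a)
qed

lemma O_sequence_truncate:
  assumes "O_sequence TYPE('k::field) a"
  shows "O_sequence TYPE('k) (\<lambda>t. if t < n then a t else 0)"
  using assms
proof (rule O_sequenceE)
  fix p M assume M: "order_ideal p M" and a: "\<And>t. a t = card (layer M t)"
  let ?M = "{m \<in> M. mono_deg m < n}"
  have "order_ideal p ?M"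
    using M by (auto simp: order_ideal_def mono_deg_add)
  moreover have "layer ?M t = (if t < n then layer M t else {})" for t
    by (auto simp: layer_def)
  ultimately show ?thesis
    by (intro O_sequenceI[of p ?M]) (simp_all add: a)
qed

text \<open>A monomial of top degree divides no other element of \<open>M\<close>, so removing it
  preserves closure under divisors.\<close>

lemma O_sequence_decrement_last:
  assumes "O_sequence TYPE('k::field) a" "a s = Suc c" "\<And>t. t > s \<Longrightarrow> a t = 0"
  shows "O_sequence TYPE('k) (a(s := c))"
  using assms(1)
proof (rule O_sequenceE)
  fix p M assume M: "order_ideal p M" and a: "\<And>t. a t = card (layer M t)"
  then have "layer M s \<noteq> {}"
    using assms(2) by force
  then obtain u where u: "u \<in> M" "mono_deg u = s"
    by (auto simp: layer_def)
  have "y = 0" if "u + y \<in> M" for y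
  proof (rule ccontr)
    assume "y \<noteq> 0"
    then have "mono_deg (u + y) > s"
      by (simp add: mono_deg_add u(2) flip: neq0_conv)
    then have "a (mono_deg (u + y)) = 0"
      by (rule assms(3))
    with layer_eq_empty[OF M _ that] a show False by metis
  qed
  then have "order_ideal p (M - {u})"
    using M unfolding order_ideal_def by fastforce
  moreover have "layer (M - {u}) t = (if t = s then layer M s - {u} else layer M t)" for t
    using u by (auto simp: layer_def)
  moreover have "card (layer M s - {u}) = c"
    using u assms(2) by (simp add: a layer_def)
  ultimately show ?thesis
    by (intro O_sequenceI[of p "M - {u}"]) (simp_all add: a)
qed

text \<open>After compression the set contains \<open>x_(p+1)\<close> to the power \<open>s\<close>,
  and every proper divisor of the next power divides this one.\<close>

lemma O_sequence_append_1:
  assumes "O_sequence TYPE('k::field) a" "a s \<noteq> 0" "\<And>t. t > s \<Longrightarrow> a t = 0"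
  shows "O_sequence TYPE('k) (a(Suc s := 1))"
  using assms(1)
proof (rule O_sequenceE)
  fix p M assume "order_ideal p M" and a: "\<And>t. a t = card (layer M t)"
  moreover have "layer M s \<noteq> {}"
    using assms(2) a by force
  ultimately obtain N where N: "order_ideal (Suc p) N" "\<And>t. card (layer N t) = a t"
    and s: "Poly_Mapping.single (Suc p) s \<in> N"
    by (metis exists_order_ideal_single)
  let ?x = "Poly_Mapping.single (Suc p) (Suc s)"
  have "order_ideal (Suc p) (insert ?x N)"
  proof (rule order_idealI)
    fix m k assume "m + Poly_Mapping.single k 1 \<in> insert ?x N"
    then consider "m + Poly_Mapping.single k 1 \<in> N" | "m + Poly_Mapping.single k 1 = ?x" by blast
    then show "m \<in> insert ?x N"
    proof cases
      case 1
      then show ?thesis using order_ideal_downward[OF N(1)] by blast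
    next
      case 2
      then have "Poly_Mapping.keys (m + Poly_Mapping.single k 1) = {Suc p}" by simp
      then have "k = Suc p" by (simp add: keys_add_nat)
      with 2 have "m + Poly_Mapping.single (Suc p) 1 = Poly_Mapping.single (Suc p) s + Poly_Mapping.single (Suc p) 1"
        by (simp flip: single_add)
      then have "m = Poly_Mapping.single (Suc p) s" by simp
      with s show ?thesis by simp
    qed
  next
    fix m assume "m \<in> insert ?x N"
    then show "Poly_Mapping.keys m \<subseteq> {1..Suc p}"
      using N(1) by (auto simp: order_ideal_def)
  qed
  moreover have "layer (insert ?x N) t = (if t = Suc s then {?x} else layer N t)" for t
  proof -
    have "mono_deg m \<noteq> Suc s" if "m \<in> N" for m
      using layer_eq_empty[OF N(1) _ that] N(2) assms(3) by simp
    then show ?thesis by (auto simp: layer_def)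
  qed
  ultimately show ?thesis
    by (intro O_sequenceI[of "Suc p" "insert ?x N"]) (simp_all add: N(2))
qed

text \<open>Realised by the monomial 1 and \<open>n\<close> variables. The cases 2 and 3 give the
  initial lists of the algorithm, and \<open>n = 0\<close> gives the list \<open>[1]\<close> after
  truncation.\<close>

lemma O_sequence_list_two: "O_sequence_list TYPE('k::field) [1, n]"
proof -
  let ?x = "\<lambda>i. Poly_Mapping.single i (1::nat)"
  let ?M = "insert 0 (?x ` {1..n})"
  have "order_ideal n ?M"
  proof (rule order_idealI)
    fix m k assume "m + ?x k \<in> ?M"
    moreover have "m + ?x k \<noteq> 0"
      by (simp flip: mono_deg_eq_0_iff add: mono_deg_add)
    ultimately obtain i where "m + ?x k = ?x i" by blast
    then have "mono_deg (m + ?x k) = mono_deg (?x i)" by (rule arg_cong)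
    then have "m = 0" by (simp add: mono_deg_add)
    then show "m \<in> ?M" by simp
  qed auto
  moreover have "layer ?M t = (if t = 0 then {0} else if t = 1 then ?x ` {1..n} else {})" for t
    by (auto simp: layer_def)
  moreover have "card (?x ` {1..n}) = n"
    by (subst card_image) (auto simp: inj_on_def poly_mapping_eq_iff fun_eq_iff lookup_single when_def)
  ultimately have "O_sequence TYPE('k) (\<lambda>t. if t = 0 then 1 else if t = 1 then n else 0)"
    by (intro O_sequenceI[of n ?M]) (simp_all)
  moreover have "nth_default 0 [1, n] = (\<lambda>t. if t = 0 then 1 else if t = 1 then n else 0)"
    by (auto simp: fun_eq_iff nth_default_def nth_Cons split: nat.splits)
  ultimately show ?thesis
    by (simp add: O_sequence_list_def)
qed

section \<open>Transfer to lists of entries\<close>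

lemma O_sequence_list_prefix:
  assumes "O_sequence_list TYPE('k::field) (xs @ ys)"
  shows "O_sequence_list TYPE('k) xs"
proof -
  have "nth_default 0 xs = (\<lambda>t. if t < length xs then nth_default 0 (xs @ ys) t else 0)"
    by (auto simp: fun_eq_iff nth_default_def nth_append)
  then show ?thesis
    using assms O_sequence_truncate by (metis O_sequence_list_def)
qed

lemma O_sequence_list_decrement_last:
  assumes "O_sequence_list TYPE('k::field) (xs @ [Suc c])"
  shows "O_sequence_list TYPE('k) (xs @ [c])"
proof -
  have "nth_default 0 (xs @ [c]) = (nth_default 0 (xs @ [Suc c]))(length xs := c)"
    by (auto simp: fun_eq_iff nth_default_def nth_append)
  then show ?thesis
    using assms O_sequence_decrement_last[of "nth_default 0 (xs @ [Suc c])" "length xs" c]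
    by (simp add: O_sequence_list_def nth_default_append nth_default_beyond)
qed

lemma O_sequence_list_append_1:
  assumes "O_sequence_list TYPE('k::field) xs" "xs \<noteq> []" "last xs \<noteq> 0"
  shows "O_sequence_list TYPE('k) (xs @ [1])"
proof -
  have len: "Suc (length xs - 1) = length xs"
    using assms(2) by simp
  have "nth_default 0 (xs @ [1]) = (nth_default 0 xs)(Suc (length xs - 1) := 1)"
    unfolding len by (auto simp: fun_eq_iff nth_default_def nth_append)
  moreover have "nth_default 0 xs (length xs - 1) \<noteq> 0"
    using assms(2,3) last_conv_nth_default[of xs 0] by simp
  ultimately show ?thesis
    using assms(1) O_sequence_append_1[of "nth_default 0 xs" "length xs - 1", where ?'k = 'k]
    unfolding O_sequence_list_def by (simp add: nth_default_beyond)
qed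

lemma O_sequence_list_butlast_nonzero:
  assumes "O_sequence_list TYPE('k::field) (xs @ [c])" "c \<noteq> 0" "xs \<noteq> []"
  shows "last xs \<noteq> 0"
proof
  assume "last xs = 0"
  then obtain zs where "xs = zs @ [0]"
    using assms(3) by (metis append_butlast_last_id)
  with assms show False
    using O_sequence_Suc_eq_0[of "nth_default 0 (xs @ [c])" "length zs", where ?'k = 'k]
    by (simp add: O_sequence_list_def nth_default_def nth_append)
qed

text \<open>A nonempty \<open>xs\<close> puts \<open>b\<close> in positive degree, where an entry 0
  or 1 cannot be followed by anything larger than 1.\<close>

lemma O_sequence_list_butlast_ge_2:
  assumes "O_sequence_list TYPE('k::field) (xs @ [b, Suc (Suc c)])" "xs \<noteq> []"
  shows "b \<ge> 2"
proof -
  let ?a = "nth_default 0 (xs @ [b, Suc (Suc c)])"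
  have a: "?a (length xs) = b" "?a (Suc (length xs)) = Suc (Suc c)"
    by (simp_all add: nth_default_def nth_append)
  have O: "O_sequence TYPE('k) ?a"
    using assms(1) by (simp add: O_sequence_list_def)
  have "b \<noteq> 0" "b \<noteq> 1"
    using O_sequence_Suc_eq_0[OF O, of "length xs"] O_sequence_Suc_le_1[OF O, of "length xs"] assms(2)
    unfolding a by auto
  then show ?thesis by simp
qed

lemma O_sequence_list_Cons_le: "O_sequence_list TYPE('k::field) (x # xs) \<Longrightarrow> x \<le> 1"
  using O_sequence_0_le[of "nth_default 0 (x # xs)"] by (simp add: O_sequence_list_def)

subsection \<open>Counting by multiplicity\<close>

text \<open>The absence of a trailing zero makes the list the unique representative of its extension
  by zero.\<close>

definition O_lists :: "'k::field itself \<Rightarrow> nat \<Rightarrow> nat list set" where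
  "O_lists K d = {xs. O_sequence_list K xs \<and> xs \<noteq> [] \<and> last xs \<noteq> 0 \<and> sum_list xs = d}"

text \<open>These are the sequences that the algorithm stores in \<open>B\<close>.\<close>

definition O_lists2 :: "'k::field itself \<Rightarrow> nat \<Rightarrow> nat list set" where
  "O_lists2 K d = {xs \<in> O_lists K d. last xs \<ge> 2}"

lemma multiplicity_seq_nth_default: "multiplicity_seq (nth_default 0 xs) = sum_list xs"
proof -
  have "multiplicity_seq (nth_default 0 xs) = (\<Sum>t<length xs. nth_default 0 xs t)"
    unfolding multiplicity_seq_def by (rule sum.mono_neutral_left) (auto simp: nth_default_eq_dflt_iff)
  also have "\<dots> = sum_list xs"
    by (simp add: sum_list_sum_nth atLeast0LessThan nth_default_nth)
  finally show ?thesis .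
qed

lemma nth_default_inject:
  assumes "nth_default 0 xs = nth_default 0 ys" "xs \<noteq> []" "ys \<noteq> []" "last xs \<noteq> 0" "last ys \<noteq> 0"
  shows "xs = ys"
proof -
  have le: "length xs \<le> length ys"
    if "nth_default 0 xs = nth_default 0 ys" "xs \<noteq> []" "last xs \<noteq> 0" for xs ys :: "'a list"
  proof (rule ccontr)
    assume "\<not> length xs \<le> length ys"
    then have "nth_default 0 ys (length xs - 1) = 0"
      by (intro nth_default_beyond) simp
    with that show False
      using last_conv_nth_default[of xs 0] by simp
  qed
  have "length xs = length ys"
    using le[of xs ys] le[of ys xs] assms by simp
  then show ?thesis
    using assms(1) by (metis nth_default_nth nth_equalityI)
qed

text \<open>The condition \<open>d > 0\<close> sets aside the zero function, the Hilbert function of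
  the zero ring, which no nonempty list without trailing zero represents.\<close>

lemma bij_betw_O_lists:
  assumes "d > 0"
  shows "bij_betw (nth_default 0) (O_lists TYPE('k::field) d)
    {a. finite_O_sequence TYPE('k) a \<and> multiplicity_seq a = d}"
  unfolding bij_betw_def
proof
  show "inj_on (nth_default 0) (O_lists TYPE('k) d)"
    by (rule inj_onI) (auto simp: O_lists_def intro: nth_default_inject)
  show "nth_default 0 ` O_lists TYPE('k) d = {a. finite_O_sequence TYPE('k) a \<and> multiplicity_seq a = d}"
  proof (intro equalityI subsetI)
    fix a assume "a \<in> nth_default 0 ` O_lists TYPE('k) d"
    then show "a \<in> {a. finite_O_sequence TYPE('k) a \<and> multiplicity_seq a = d}"
      by (auto simp: O_lists_def O_sequence_list_def finite_O_sequence_def multiplicity_seq_nth_default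
          intro: nth_default_beyond)
  next
    fix a assume "a \<in> {a. finite_O_sequence TYPE('k) a \<and> multiplicity_seq a = d}"
    then have O: "O_sequence TYPE('k) a" and ex: "\<exists>N. \<forall>t\<ge>N. a t = 0" and d: "multiplicity_seq a = d"
      by (auto simp: finite_O_sequence_def)
    \<comment> \<open>By minimality \<open>n - 1\<close> is the last index with a nonzero value, so
      the first \<open>n\<close> values form the required list.\<close>
    define n where "n = (LEAST N. \<forall>t\<ge>N. a t = 0)"
    have n: "\<forall>t\<ge>n. a t = 0"
      unfolding n_def using ex by (rule LeastI_ex)
    have "n \<noteq> 0"
    proof
      assume "n = 0"
      with n have "multiplicity_seq a = 0" by (simp add: multiplicity_seq_def)
      with d \<open>d > 0\<close> show False by simp
    qed
    have "a (n - 1) \<noteq> 0"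
    proof
      assume last: "a (n - 1) = 0"
      have "a t = 0" if "t \<ge> n - 1" for t
      proof (cases "t = n - 1")
        case False
        with that have "t \<ge> n" by linarith
        with n show ?thesis by blast
      qed (use last in simp)
      then have "\<forall>t\<ge>n - 1. a t = 0" by blast
      then have "n \<le> n - 1"
        unfolding n_def by (rule Least_le)
      with \<open>n \<noteq> 0\<close> show False by simp
    qed
    have a: "nth_default 0 (map a [0..<n]) = a"
      using n by (auto simp: fun_eq_iff nth_default_def)
    have "map a [0..<n] \<in> O_lists TYPE('k) d"
      using O d multiplicity_seq_nth_default[of "map a [0..<n]"] \<open>n \<noteq> 0\<close> \<open>a (n - 1) \<noteq> 0\<close>
      unfolding O_lists_def O_sequence_list_def by (simp add: last_map a)
    with a show "a \<in> nth_default 0 ` O_lists TYPE('k) d" by (metis imageI)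
  qed
qed

lemma num_O_sequences_eq: "d > 0 \<Longrightarrow> num_O_sequences TYPE('k::field) d = card (O_lists TYPE('k) d)"
  by (simp add: num_O_sequences_def bij_betw_same_card[OF bij_betw_O_lists])

text \<open>A first entry 0 would force all later entries to vanish, including the last.\<close>

lemma O_lists_Cons_eq_1:
  assumes "x # xs \<in> O_lists TYPE('k::field) d"
  shows "x = 1"
proof -
  have O: "O_sequence_list TYPE('k) (x # xs)" and last: "last (x # xs) \<noteq> 0"
    using assms by (simp_all add: O_lists_def)
  have "nth_default 0 (x # xs) t = 0" if "x = 0" for t
    using that O O_sequence_Suc_eq_0[of "nth_default 0 (x # xs)", where ?'k = 'k]
    by (induction t) (simp_all add: O_sequence_list_def del: nth_default_Cons_Suc)
  then have "x \<noteq> 0"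
    using last by (metis last_conv_nth_default list.distinct(1))
  with O_sequence_list_Cons_le[OF O] show ?thesis by simp
qed

lemma O_lists_1: "O_lists TYPE('k::field) 1 = {[1]}"
proof -
  have "xs = []" if "x # xs \<in> O_lists TYPE('k) 1" for x xs
  proof (rule ccontr)
    assume "xs \<noteq> []"
    moreover have "sum_list xs = 0"
      using that O_lists_Cons_eq_1[OF that] by (simp add: O_lists_def)
    ultimately have "last xs = 0"
      by (simp add: sum_list_eq_0_iff)
    with that \<open>xs \<noteq> []\<close> show False by (simp add: O_lists_def)
  qed
  then have "xs = [1]" if "xs \<in> O_lists TYPE('k) 1" for xs
  proof (cases xs)
    case Nil
    with that show ?thesis by (simp add: O_lists_def)
  next
    case (Cons x ys)
    with \<open>\<And>x xs. x # xs \<in> O_lists TYPE('k) 1 \<Longrightarrow> xs = []\<close> that O_lists_Cons_eq_1 show ?thesis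
      by blast
  qed
  moreover have "[1] \<in> O_lists TYPE('k) 1"
    using O_sequence_list_prefix[of "[1]" "[0]", where ?'k = 'k] O_sequence_list_two[of 0, where ?'k = 'k]
    by (simp add: O_lists_def)
  ultimately show ?thesis by blast
qed

lemma O_lists_Suc:
  assumes "d > 0"
  shows "O_lists TYPE('k::field) (Suc d) = (\<lambda>xs. xs @ [1]) ` O_lists TYPE('k) d \<union> O_lists2 TYPE('k) (Suc d)"
proof (intro equalityI subsetI)
  fix xs assume xs: "xs \<in> O_lists TYPE('k) (Suc d)"
  then obtain ys c where ys: "xs = ys @ [c]" "c \<noteq> 0"
    by (cases xs rule: rev_cases) (auto simp: O_lists_def)
  show "xs \<in> (\<lambda>xs. xs @ [1]) ` O_lists TYPE('k) d \<union> O_lists2 TYPE('k) (Suc d)"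
  proof (cases "c = 1")
    case False
    with ys xs show ?thesis by (auto simp: O_lists2_def)
  next
    case True
    \<comment> \<open>An empty \<open>ys\<close> would leave multiplicity 1, contrary to
      \<open>d > 0\<close>.\<close>
    have "ys \<noteq> []"
      using assms True ys xs by (auto simp: O_lists_def)
    moreover have "last ys \<noteq> 0"
      using O_sequence_list_butlast_nonzero[of ys c, where ?'k = 'k] xs ys \<open>ys \<noteq> []\<close>
      by (simp add: O_lists_def)
    moreover have "O_sequence_list TYPE('k) ys"
      using xs ys O_sequence_list_prefix[of ys "[c]", where ?'k = 'k] by (simp add: O_lists_def)
    ultimately have "ys \<in> O_lists TYPE('k) d"
      using xs ys True by (simp add: O_lists_def)
    with ys True show ?thesis by blast
  qed
next
  fix xs assume "xs \<in> (\<lambda>xs. xs @ [1]) ` O_lists TYPE('k) d \<union> O_lists2 TYPE('k) (Suc d)"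
  then show "xs \<in> O_lists TYPE('k) (Suc d)"
    using O_sequence_list_append_1 by (auto simp: O_lists_def O_lists2_def)
qed

text \<open>There are no inner zeros, so both the length and the entries are bounded by the
  sum.\<close>

lemma finite_O_lists: "d > 0 \<Longrightarrow> finite (O_lists TYPE('k::field) d)"
proof -
  have "length xs \<le> sum_list xs" if "O_sequence_list TYPE('k) xs" "xs \<noteq> []" "last xs \<noteq> 0" for xs
    using that
  proof (induction xs rule: rev_induct)
    case (snoc x xs)
    show ?case
    proof (cases "xs = []")
      case False
      have "last xs \<noteq> 0"
        using O_sequence_list_butlast_nonzero[of xs x, where ?'k = 'k] snoc.prems False by simp
      with snoc False O_sequence_list_prefix[of xs "[x]", where ?'k = 'k] show ?thesis by simp
    qed (use snoc.prems in simp)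
  qed simp
  then have "O_lists TYPE('k) d \<subseteq> {xs. set xs \<subseteq> {..d} \<and> length xs \<le> d}"
    by (auto simp: O_lists_def dest: member_le_sum_list)
  then show ?thesis
    by (rule finite_subset) (simp add: finite_lists_length_le)
qed

lemma card_O_lists_Suc:
  assumes "d > 0"
  shows "card (O_lists TYPE('k::field) (Suc d)) = card (O_lists2 TYPE('k) (Suc d)) + card (O_lists TYPE('k) d)"
proof -
  have "finite (O_lists2 TYPE('k) (Suc d))"
    using finite_O_lists[of "Suc d", where ?'k = 'k] by (simp add: O_lists2_def)
  moreover have "(\<lambda>xs. xs @ [1]) ` O_lists TYPE('k) d \<inter> O_lists2 TYPE('k) (Suc d) = {}"
    by (auto simp: O_lists2_def)
  moreover have "card ((\<lambda>xs. xs @ [1]) ` O_lists TYPE('k) d) = card (O_lists TYPE('k) d)"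
    by (simp add: card_image inj_on_def)
  ultimately show ?thesis
    by (simp add: O_lists_Suc[OF assms] card_Un_disjoint finite_O_lists[OF assms])
qed

section \<open>Recursion for the sequences not ending in 1\<close>

lemma O_lists2_snoc:
  assumes "xs \<in> O_lists2 TYPE('k::field) d"
  obtains ys c where "xs = 1 # ys @ [Suc (Suc c)]"
proof -
  obtain zs n where "xs = zs @ [n]" "n \<ge> 2"
    using assms by (cases xs rule: rev_cases) (auto simp: O_lists2_def O_lists_def)
  moreover from this(2) obtain c where "n = Suc (Suc c)"
    by (metis add_2_eq_Suc le_Suc_ex)
  ultimately have zs: "xs = zs @ [Suc (Suc c)]" by simp
  \<comment> \<open>With \<open>zs\<close> empty, the last entry would also be the first, which is
    1.\<close>
  with assms O_lists_Cons_eq_1[where ?'k = 'k] have "zs \<noteq> []"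
    by (fastforce simp: O_lists2_def)
  then obtain ys where "zs = 1 # ys"
    using assms zs O_lists_Cons_eq_1[where ?'k = 'k] by (cases zs) (auto simp: O_lists2_def)
  with zs that show thesis by simp
qed

text \<open>The last entry tells which operation is to be undone: a 2 was appended, and a larger
  entry was incremented.\<close>

lemma O_lists2_rec:
  assumes "d \<ge> 5"
  shows "O_lists2 TYPE('k::field) d =
    {xs \<in> (\<lambda>a. a @ [2]) ` O_lists2 TYPE('k) (d - 2). O_sequence_list TYPE('k) xs} \<union>
    {xs \<in> (\<lambda>a. butlast a @ [last a + 1]) ` O_lists2 TYPE('k) (d - 1). O_sequence_list TYPE('k) xs}"
    (is "_ = ?A \<union> ?B")
proof (intro equalityI subsetI)
  fix xs assume xs: "xs \<in> O_lists2 TYPE('k) d"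
  then obtain ys c where ys: "xs = 1 # ys @ [Suc (Suc c)]"
    by (rule O_lists2_snoc)
  have O: "O_sequence_list TYPE('k) xs" and d: "sum_list xs = d"
    using xs by (simp_all add: O_lists2_def O_lists_def)
  show "xs \<in> ?A \<union> ?B"
  proof (cases c)
    case 0
    \<comment> \<open>The list \<open>[1, 2]\<close> is the only one with nothing between the 1 and
      a final 2; its multiplicity 3 is excluded by \<open>d \<ge> 5\<close>.\<close>
    with ys d assms have "ys \<noteq> []" by auto
    then obtain zs b where zs: "ys = zs @ [b]"
      by (metis rev_exhaust)
    \<comment> \<open>This puts the list without its final 2 back among the sequences not ending in
      1.\<close>
    have "b \<ge> 2"
      using O_sequence_list_butlast_ge_2[of "1 # zs" b 0, where ?'k = 'k] O
      by (simp add: ys zs 0)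
    moreover have "O_sequence_list TYPE('k) (1 # ys)"
      using O_sequence_list_prefix[of "1 # ys" "[2]", where ?'k = 'k] O by (simp add: ys 0 numeral_2_eq_2)
    ultimately have "1 # ys \<in> O_lists2 TYPE('k) (d - 2)"
      using d by (auto simp: O_lists2_def O_lists_def ys zs 0)
    then show ?thesis
      using O ys 0 by (auto simp: numeral_2_eq_2)
  next
    case (Suc c')
    have "O_sequence_list TYPE('k) (1 # ys @ [Suc (Suc c')])"
      using O_sequence_list_decrement_last[of "1 # ys" "Suc (Suc c')", where ?'k = 'k] O
      by (simp add: ys Suc)
    then have "1 # ys @ [Suc (Suc c')] \<in> O_lists2 TYPE('k) (d - 1)"
      using d by (auto simp: O_lists2_def O_lists_def ys Suc)
    then have "(\<lambda>a. butlast a @ [last a + 1]) (1 # ys @ [Suc (Suc c')])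
        \<in> (\<lambda>a. butlast a @ [last a + 1]) ` O_lists2 TYPE('k) (d - 1)"
      by (rule imageI)
    then show ?thesis
      using O ys Suc by (simp add: butlast_append)
  qed
next
  fix xs assume "xs \<in> ?A \<union> ?B"
  then show "xs \<in> O_lists2 TYPE('k) d"
  proof
    assume "xs \<in> ?A"
    with assms show ?thesis by (auto simp: O_lists2_def O_lists_def)
  next
    assume "xs \<in> ?B"
    then obtain a where a: "a \<in> O_lists2 TYPE('k) (d - 1)" and xs: "xs = butlast a @ [last a + 1]"
      "O_sequence_list TYPE('k) xs"
      by blast
    from a obtain ys c where "a = 1 # ys @ [Suc (Suc c)]"
      by (rule O_lists2_snoc)
    with a xs assms show ?thesis
      by (auto simp: O_lists2_def O_lists_def butlast_append)
  qed
qed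

lemma set_new_sequences:
  assumes "d \<ge> 5" "set B2 = O_lists2 TYPE('k::field) (d - 2)" "set B1 = O_lists2 TYPE('k) (d - 1)"
  shows "set (new_sequences TYPE('k) B2 B1) = O_lists2 TYPE('k) d"
  unfolding O_lists2_rec[OF assms(1)] new_sequences_def using assms(2,3) by auto

text \<open>The algorithm counts by list length, so repetitions must be ruled out. The two halves
  are disjoint because appended lists end in 2 and incremented ones in at least 3.\<close>

lemma distinct_new_sequences:
  assumes "distinct B2" "distinct B1" "set B1 = O_lists2 TYPE('k::field) d"
  shows "distinct (new_sequences TYPE('k) B2 B1)"
proof -
  have ge: "a \<noteq> [] \<and> last a \<ge> 2" if "a \<in> set B1" for a
    using that assms(3) by (simp add: O_lists2_def O_lists_def)
  have "inj_on (\<lambda>a. butlast a @ [last a + 1]) (set B1)"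
  proof (rule inj_onI)
    fix x y assume "x \<in> set B1" "y \<in> set B1" "butlast x @ [last x + 1] = butlast y @ [last y + 1]"
    then have "butlast x = butlast y" "last x = last y" "x \<noteq> []" "y \<noteq> []"
      using ge by simp_all
    then show "x = y"
      by (metis append_butlast_last_id)
  qed
  then have "distinct (map (\<lambda>a. butlast a @ [last a + 1]) B1)"
    using assms(2) by (simp add: distinct_map)
  moreover have "distinct (map (\<lambda>a. a @ [2]) B2)"
    using assms(1) by (simp add: distinct_map inj_on_def)
  moreover have "a @ [2] \<noteq> b @ [last b' + 1]" if "b' \<in> set B1" for a b b'
    using ge[OF that] by simp
  ultimately show ?thesis
    by (auto simp: new_sequences_def)
qed

lemma O_lists2_3: "O_lists2 TYPE('k::field) 3 = {[1, 2]}"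
proof (intro equalityI subsetI)
  fix xs assume xs: "xs \<in> O_lists2 TYPE('k) 3"
  then obtain ys c where ys: "xs = 1 # ys @ [Suc (Suc c)]"
    by (rule O_lists2_snoc)
  with xs have sum: "sum_list ys = 0" "c = 0"
    by (simp_all add: O_lists2_def O_lists_def)
  \<comment> \<open>The entry before the last would be at least 2, more than the sum of
    \<open>ys\<close> allows.\<close>
  have "ys = []"
  proof (rule ccontr)
    assume "ys \<noteq> []"
    then obtain zs b where zs: "ys = zs @ [b]"
      by (metis rev_exhaust)
    with O_sequence_list_butlast_ge_2[of "1 # zs" b c, where ?'k = 'k] xs ys sum show False
      by (auto simp: O_lists2_def O_lists_def)
  qed
  with ys sum show "xs \<in> {[1, 2]}" by simp
qed (use O_sequence_list_two[of 2, where ?'k = 'k] in \<open>simp add: O_lists2_def O_lists_def\<close>)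

lemma O_lists2_4: "O_lists2 TYPE('k::field) 4 = {[1, 3]}"
proof (intro equalityI subsetI)
  fix xs assume xs: "xs \<in> O_lists2 TYPE('k) 4"
  then obtain ys c where ys: "xs = 1 # ys @ [Suc (Suc c)]"
    by (rule O_lists2_snoc)
  with xs have sum: "sum_list ys + c = 1"
    by (simp add: O_lists2_def O_lists_def)
  \<comment> \<open>As before, an inner entry of at least 2 exceeds the sum available to
    \<open>ys\<close>.\<close>
  have "ys = []"
  proof (rule ccontr)
    assume "ys \<noteq> []"
    then obtain zs b where zs: "ys = zs @ [b]"
      by (metis rev_exhaust)
    with O_sequence_list_butlast_ge_2[of "1 # zs" b c, where ?'k = 'k] xs ys sum show False
      by (auto simp: O_lists2_def O_lists_def)
  qed
  with ys sum show "xs \<in> {[1, 3]}" by simp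
qed (use O_sequence_list_two[of 3, where ?'k = 'k] in \<open>simp add: O_lists2_def O_lists_def\<close>)

lemma O_lists2_2: "O_lists2 TYPE('k::field) 2 = {}"
proof -
  have "xs \<notin> O_lists2 TYPE('k) 2" for xs
  proof
    assume xs: "xs \<in> O_lists2 TYPE('k) 2"
    then obtain ys c where "xs = 1 # ys @ [Suc (Suc c)]"
      by (rule O_lists2_snoc)
    with xs show False by (simp add: O_lists2_def O_lists_def)
  qed
  then show ?thesis by blast
qed

section \<open>Recursion for the counts and the loop invariant\<close>

lemma num_O_sequences_1: "num_O_sequences TYPE('k::field) 1 = 1"
  by (simp add: num_O_sequences_eq O_lists_1[simplified])

lemma num_O_sequences_rec:
  assumes "d > 1"
  shows "num_O_sequences TYPE('k::field) d =
    card (O_lists2 TYPE('k) d) + num_O_sequences TYPE('k) (d - 1)"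
  using assms card_O_lists_Suc[of "d - 1", where ?'k = 'k] by (simp add: num_O_sequences_eq)

text \<open>\<open>ctr_d\<close> is the next multiplicity to be treated. The slot at
  \<open>ptr_h\<close> is overwritten before it is read, and only the length of
  \<open>list_A\<close> is recorded because each step reads just the entry it has appended. The set
  equation says that the pointers are a permutation of 1, 2, 3.\<close>

definition alg_invariant :: "'k::field itself \<Rightarrow> alg_state \<Rightarrow> bool" where
  "alg_invariant K s \<longleftrightarrow>
     ctr_d s \<ge> 5 \<and> list_O s = map (num_O_sequences K) [1..<ctr_d s] \<and>
     length (list_A s) = ctr_d s - 1 \<and> length (list_B s) = 3 \<and>
     {ptr_h2 s, ptr_h1 s, ptr_h s} = {1, 2, 3} \<and>
     distinct (at1 (list_B s) (ptr_h2 s)) \<and> distinct (at1 (list_B s) (ptr_h1 s)) \<and>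
     set (at1 (list_B s) (ptr_h2 s)) = O_lists2 K (ctr_d s - 2) \<and>
     set (at1 (list_B s) (ptr_h1 s)) = O_lists2 K (ctr_d s - 1)"

lemma alg_invariant_init: "alg_invariant TYPE('k::field) alg_init"
proof -
  have "num_O_sequences TYPE('k) 2 = 1"
    using num_O_sequences_rec[of 2, where ?'k = 'k] num_O_sequences_1[where ?'k = 'k]
    by (simp add: O_lists2_2)
  moreover from this have "num_O_sequences TYPE('k) 3 = 2"
    using num_O_sequences_rec[of 3, where ?'k = 'k] by (simp add: O_lists2_3)
  moreover from this have "num_O_sequences TYPE('k) 4 = 3"
    using num_O_sequences_rec[of 4, where ?'k = 'k] by (simp add: O_lists2_4)
  moreover have "[1..<5] = [1, 2, 3, 4::nat]"
    by (simp add: upt_conv_Cons)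
  ultimately show ?thesis
    using num_O_sequences_1[where ?'k = 'k]
    by (auto simp: alg_invariant_def alg_init_def at1_def O_lists2_3 O_lists2_4)
qed

lemma at1_update1_same: "i \<in> {1..length xs} \<Longrightarrow> at1 (update1 xs i x) i = x"
  by (auto simp: at1_def update1_def)

lemma at1_update1_other: "i \<ge> 1 \<Longrightarrow> j \<ge> 1 \<Longrightarrow> i \<noteq> j \<Longrightarrow> at1 (update1 xs i x) j = at1 xs j"
  by (auto simp: at1_def update1_def)

lemma alg_invariant_step:
  assumes "alg_invariant TYPE('k::field) s"
  shows "alg_invariant TYPE('k) (alg_step TYPE('k) s)"
proof -
  let ?d = "ctr_d s"
  let ?N = "new_sequences TYPE('k) (at1 (list_B s) (ptr_h2 s)) (at1 (list_B s) (ptr_h1 s))"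
  let ?B = "update1 (list_B s) (ptr_h s) ?N"
  have d: "?d \<ge> 5" and Out: "list_O s = map (num_O_sequences TYPE('k)) [1..<?d]"
    and lenA: "length (list_A s) = ?d - 1" and lenB: "length (list_B s) = 3"
    and ptr: "{ptr_h2 s, ptr_h1 s, ptr_h s} = {1, 2, 3}"
    and dist: "distinct (at1 (list_B s) (ptr_h2 s))" "distinct (at1 (list_B s) (ptr_h1 s))"
    and B: "set (at1 (list_B s) (ptr_h2 s)) = O_lists2 TYPE('k) (?d - 2)"
      "set (at1 (list_B s) (ptr_h1 s)) = O_lists2 TYPE('k) (?d - 1)"
    using assms by (simp_all add: alg_invariant_def)
  have "ptr_h1 s \<in> {1, 2, 3}" "ptr_h s \<in> {1, 2, 3}"
    unfolding ptr[symmetric] by simp_all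
  \<comment> \<open>Three distinct values force distinct pointers, so writing slot
    \<open>ptr_h\<close> leaves slot \<open>ptr_h1\<close> intact for the next step.\<close>
  moreover have "ptr_h1 s \<noteq> ptr_h s"
  proof
    assume "ptr_h1 s = ptr_h s"
    with ptr have "card {1, 2, 3 :: nat} = card {ptr_h2 s, ptr_h s}" by simp
    also have "\<dots> \<le> 2" by (simp add: card_insert_if)
    finally show False by simp
  qed
  ultimately have atB: "at1 ?B (ptr_h s) = ?N" "at1 ?B (ptr_h1 s) = at1 (list_B s) (ptr_h1 s)"
    using lenB by (auto intro!: at1_update1_same at1_update1_other)
  have setN: "set ?N = O_lists2 TYPE('k) ?d"
    using d B by (rule set_new_sequences)
  have distN: "distinct ?N"
    using dist B(2) by (rule distinct_new_sequences)
  \<comment> \<open>With indexing from 1 and previous length \<open>?d - 1\<close>, position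
    \<open>?d\<close> holds the new entry.\<close>
  have "at1 (list_A s @ [length ?N]) ?d = length ?N"
    using lenA by (simp add: at1_def nth_append)
  also have "\<dots> = card (O_lists2 TYPE('k) ?d)"
    using distinct_card[OF distN] setN by simp
  finally have A: "at1 (list_A s @ [length ?N]) ?d = card (O_lists2 TYPE('k) ?d)" .
  have "at1 (list_O s) (?d - 1) = num_O_sequences TYPE('k) (?d - 1)"
  proof -
    have "[1..<?d] ! (?d - 1 - 1) = ?d - 1"
      using d by (subst nth_upt) auto
    with d show ?thesis by (simp add: at1_def Out nth_map del: nth_upt)
  qed
  then have "at1 (list_A s @ [length ?N]) ?d + at1 (list_O s) (?d - 1) = num_O_sequences TYPE('k) ?d"
    using num_O_sequences_rec[of ?d, where ?'k = 'k] d A by simp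
  moreover have "{ptr_h1 s, ptr_h s, ptr_h2 s} = {1, 2, 3}"
    using ptr by (simp add: insert_commute)
  moreover have "length ?B = 3"
    by (simp add: update1_def lenB)
  ultimately show ?thesis
    using d lenA dist(2) distN setN B(2)
    by (simp add: alg_invariant_def alg_step_def Let_def atB Out)
qed

theorem proposition3p1:
  fixes D :: nat
  assumes "D \<ge> 4"
  shows "OSequences TYPE('k::field) D = Some (map (num_O_sequences TYPE('k)) [1..<D + 1])"
proof -
  let ?s = "\<lambda>n. (alg_step TYPE('k) ^^ n) alg_init"
  have d: "ctr_d (?s n) = n + 5" for n
    by (induction n) (simp_all add: alg_init_def alg_step_def Let_def)
  have inv: "alg_invariant TYPE('k) (?s n)" for n
    by (induction n) (simp_all add: alg_invariant_init alg_invariant_step)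
  \<comment> \<open>The counter starts at 5, so the loop test first fails after \<open>D - 4\<close>
    steps. The subtraction is exact because \<open>D \<ge> 4\<close>, and \<open>D = 4\<close>
    returns the initial list.\<close>
  have "(LEAST n. \<not> ctr_d (?s n) \<le> D) = D - 4"
    by (rule Least_equality) (use assms d in auto)
  moreover have "\<exists>n. \<not> ctr_d (?s n) \<le> D"
    using d by (intro exI[of _ D]) simp
  ultimately have "OSequences TYPE('k) D = Some (list_O (?s (D - 4)))"
    by (simp add: OSequences_def while_option_def)
  moreover have "list_O (?s (D - 4)) = map (num_O_sequences TYPE('k)) [1..<D + 1]"
    using inv[of "D - 4"] d[of "D - 4"] assms by (simp add: alg_invariant_def)
  ultimately show ?thesis by simp
qed

end
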